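(* Let $n$ be a squarefree odd positive integer. Then $\varrho(n)=[\mathbb{Q}(\zeta_n):K_n]$ is a positive integer. In particular, $2^{\omega(n)}\mid\varphi(n)$.
   Context: $\varphi$ is Euler's totient function, $\omega(n)$ is the number of distinct prime divisors of $n$, and $\varrho(n):=\varphi(n)/2^{\omega(n)}$. $\mathbb{Q}(\zeta_n)$ is the $n$-th cyclotomic field. For squarefree odd $n=p_1\cdots p_k$ with distinct odd primes $p_i$, put $p_i^*=(-1)^{(p_i-1)/2}p_i$; then $\mathbb{Q}(\sqrt{p_i^*})\subset\mathbb{Q}(\zeta_{p_i})\subset\mathbb{Q}(\zeta_n)$, and $K_n:=\mathbb{Q}(\sqrt{p_1^*},\dots,\sqrt{p_k^*})\subseteq\mathbb{Q}(\zeta_n)$ (the compositum of the quadratic subfields of $\mathbb{Q}(\zeta_n)$). *)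

theory Defs
  imports
    Complex_Main
    "HOL-Number_Theory.Totient"
    "HOL-Computational_Algebra.Squarefree"
    "HOL-Algebra.Embedded_Algebras"
    "HOL-Algebra.Generated_Fields"
    "HOL-Algebra.Algebraic_Closure_Type"
begin

text \<open>All fields are subfields of the complex numbers, seen as a record of the algebra library.\<close>

abbreviation complex_field :: "complex ring" where
  "complex_field \<equiv> ring_of_type_algebra"

definition rat_adjoin :: "complex set \<Rightarrow> complex set" where
  "rat_adjoin S = generate_field complex_field (\<rat> \<union> S)"

lemma subfield_rat_adjoin: "subfield (rat_adjoin S) complex_field"
  unfolding rat_adjoin_def
  by (rule field.generate_field_is_subfield[OF field_from_type_algebra])
     (simp add: ring_of_type_algebra_def)

text \<open>As \<^const>\<open>ring.dim\<close> is a definite description, the degree is meaningful only if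
  \<^term>\<open>ring.finite_dimension complex_field K E\<close> holds.\<close>

definition field_degree :: "complex set \<Rightarrow> complex set \<Rightarrow> nat" where
  "field_degree E K = (ring.dim complex_field over K) E"

definition cyclotomic_field :: "nat \<Rightarrow> complex set" where
  "cyclotomic_field n = rat_adjoin {exp (2 * of_real pi * \<i> / of_nat n)}"

definition prime_star :: "nat \<Rightarrow> int" where
  "prime_star p = (-1) ^ ((p - 1) div 2) * int p"

text \<open>The generated field does not depend on which square root is chosen.\<close>

definition multiquadratic_field :: "nat \<Rightarrow> complex set" where
  "multiquadratic_field n =
     rat_adjoin ((\<lambda>p. csqrt (of_int (prime_star p))) ` prime_factors n)"

definition prime_omega :: "nat \<Rightarrow> nat" where
  "prime_omega n = card (prime_factors n)"

definition varrho :: "nat \<Rightarrow> rat" where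
  "varrho n = of_nat (totient n) / 2 ^ prime_omega n"

end

theory Submission
  imports Defs
begin

text \<open>
  Let \<open>L\<close> be the \<open>n\<close>-th cyclotomic field and \<open>K\<close> the multiquadratic one. The proof computes both
  degrees over the rationals and divides: \<open>[L : \<rat>] = \<phi>(n)\<close>, \<open>[K : \<rat>] = 2 ^ \<omega>(n)\<close> and
  \<open>K \<subseteq> L\<close>, so that the tower law gives \<open>\<phi>(n) = 2 ^ \<omega>(n) * [L : K]\<close>, from which all claims
  follow.

  The degree of \<open>L\<close> (\<open>cyclotomic_degree\<close>) is the irreducibility of the cyclotomic polynomial,
  in the form that the minimal polynomial \<open>f\<close> of a primitive \<open>n\<close>-th root of unity \<open>z\<close> has degree
  \<open>\<phi>(n)\<close>. The main point is that \<open>z ^ r\<close> is a root of \<open>f\<close> for each \<open>r\<close> coprime to \<open>n\<close>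
  (\<open>int_minpoly_coprime_power\<close>), which is shown by Landau's argument: for a prime \<open>p\<close> the
  Frobenius congruence makes \<open>f(z ^ p)\<close> divisible by \<open>p\<close>, while this value ranges over a finite set
  as \<open>p\<close> varies. So it vanishes for all large primes, and every residue class coprime to \<open>n\<close>
  contains a product of large primes.

  The degree of \<open>K\<close> comes from a criterion valid over any subfield of the complex numbers
  (\<open>multiquadratic_degree\<close>): adjoining a set of square roots, no nonempty product of which lies in
  the base field, multiplies the degree by two for each root. For the square roots of the numbers
  \<open>p*\<close> the products are irrational by unique factorization.

  The inclusion \<open>K \<subseteq> L\<close> is seen from \<open>p = (1 - y) * ... * (1 - y ^ (p - 1))\<close> for a primitive
  \<open>p\<close>-th root of unity \<open>y\<close>: pairing \<open>k\<close> with \<open>p - k\<close> exhibits \<open>p*\<close> as a square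
  (\<open>sqrt_prime_star_in_cyclotomic\<close>).
\<close>

(* The constants of the same names for record-based structures would shadow those of the type
   classes. *)
hide_const (open) Divisibility.prime Polynomials.degree Polynomials.lead_coeff UnivPoly.monom UnivPoly.coeff

section \<open>Integer polynomials evaluated at complex numbers\<close>

abbreviation ipoly :: "int poly \<Rightarrow> complex \<Rightarrow> complex" where
  "ipoly f z \<equiv> poly (map_poly of_int f) z"

lemma ipoly_add: "ipoly (f + g) z = ipoly f z + ipoly g z"
  by (induct f g rule: poly_induct2) (simp_all add: map_poly_pCons algebra_simps)

lemma ipoly_smult: "ipoly (smult c f) z = of_int c * ipoly f z"
  by (induct f) (simp_all add: map_poly_pCons algebra_simps)

lemma ipoly_diff: "ipoly (f - g) z = ipoly f z - ipoly g z"
  using ipoly_add[of f "- g" z] ipoly_smult[of "-1" g z] by simp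

lemma ipoly_mult: "ipoly (f * g) z = ipoly f z * ipoly g z"
  by (induct f) (simp_all add: map_poly_pCons algebra_simps ipoly_add ipoly_smult)

lemma ipoly_power: "ipoly (f ^ k) z = ipoly f z ^ k"
  by (induct k) (simp_all add: ipoly_mult)

lemma ipoly_monom: "ipoly (monom 1 k) z = z ^ k"
  by (simp add: map_poly_monom poly_monom)

lemma ipoly_pcompose_monom: "ipoly (pcompose f (monom 1 k)) z = ipoly f (z ^ k)"
  by (induct f) (simp_all add: pcompose_pCons map_poly_pCons ipoly_add ipoly_mult ipoly_monom)

lemma ipoly_dvd: "f dvd g \<Longrightarrow> ipoly f z = 0 \<Longrightarrow> ipoly g z = 0"
  by (auto elim!: dvdE simp: ipoly_mult)

lemmas ipoly_simps = ipoly_add ipoly_smult ipoly_diff ipoly_mult ipoly_power ipoly_monom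
  ipoly_pcompose_monom

section \<open>The Frobenius congruence\<close>

text \<open>All binomial coefficients strictly inside the \<open>p\<close>-th row are divisible by \<open>p\<close>. The statement is
  a divisibility in an arbitrary commutative ring, so that it applies to \<^typ>\<open>int\<close> and
  to \<^typ>\<open>int poly\<close> without passing to a quotient of characteristic \<open>p\<close>.\<close>

lemma freshmans_dream_dvd:
  fixes x y :: "'a :: comm_ring_1"
  assumes "prime p"
  shows "of_nat p dvd (x + y) ^ p - (x ^ p + y ^ p)"
proof -
  have p: "p > 0" using assms prime_gt_0_nat by blast
  have "(x + y) ^ p = (\<Sum>k\<le>p. of_nat (p choose k) * x ^ k * y ^ (p - k))"
    by (rule binomial_ring)
  also have "{..p} = {0, p} \<union> {0<..<p}" using p by auto
  also have "(\<Sum>k\<in>{0, p} \<union> {0<..<p}. of_nat (p choose k) * x ^ k * y ^ (p - k)) =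
      (x ^ p + y ^ p) + (\<Sum>k\<in>{0<..<p}. of_nat (p choose k) * x ^ k * y ^ (p - k))"
    using p by (subst sum.union_disjoint) auto
  finally have eq: "(x + y) ^ p - (x ^ p + y ^ p) =
      (\<Sum>k\<in>{0<..<p}. of_nat (p choose k) * x ^ k * y ^ (p - k))" by simp
  have "of_nat p dvd (of_nat (p choose k) :: 'a)" if "k \<in> {0<..<p}" for k
  proof -
    have "p dvd (p choose k)" using dvd_choose_prime[of k p] that assms by auto
    thus ?thesis unfolding dvd_def by (metis of_nat_mult)
  qed
  thus ?thesis unfolding eq by (intro dvd_sum dvd_mult2) auto
qed

lemma fermat_int:
  assumes "prime p"
  shows "int p dvd a ^ p - a"
proof -
  have p: "p > 0" using assms prime_gt_0_nat by blast
  have step: "int p dvd (b + 1) ^ p - (b + 1) \<longleftrightarrow> int p dvd b ^ p - b" for b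
  proof -
    have "(b + 1) ^ p - (b + 1) = ((b + 1) ^ p - (b ^ p + 1 ^ p)) + (b ^ p - b)"
      by simp
    thus ?thesis using freshmans_dream_dvd[OF assms, of b 1] by (metis dvd_add_right_iff of_nat_id)
  qed
  show ?thesis
  proof (induct a rule: int_induct[where k = 0])
    case base
    show ?case using p by (simp add: power_0_left)
  next
    case (step1 i)
    thus ?case using step[of i] by simp
  next
    case (step2 i)
    thus ?case using step[of "i - 1"] by simp
  qed
qed

text \<open>Expanding \<open>f ^ p\<close> coefficient by coefficient, the mixed terms vanish modulo \<open>p\<close>, and
  \<open>fermat_int\<close> turns each \<open>a ^ p\<close> back into \<open>a\<close>. Hence \<open>f(X ^ p)\<close> is
  congruent to \<open>f(X) ^ p\<close> modulo \<open>p\<close>.\<close>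

lemma frobenius_int_poly:
  assumes "prime p"
  shows "of_nat p dvd (pcompose f (monom 1 p) - f ^ p :: int poly)"
proof (induct f)
  case 0
  show ?case using assms prime_gt_0_nat by (simp add: power_0_left)
next
  case (pCons a f)
  have eq: "pCons a f = [:a:] + monom 1 1 * f" by (simp add: monom_Suc)
  have m: "monom 1 1 ^ p = (monom 1 p :: int poly)" by (simp only: monom_power mult_1 power_one)
  have c: "[:a:] ^ p = [:a ^ p:]" by (simp add: poly_const_pow)
  have "pcompose (pCons a f) (monom 1 p) - pCons a f ^ p =
     monom 1 p * (pcompose f (monom 1 p) - f ^ p) - ([:a:] ^ p - [:a:])
     - (([:a:] + monom 1 1 * f) ^ p - ([:a:] ^ p + (monom 1 1 * f) ^ p))"
    unfolding eq[symmetric] by (simp add: pcompose_pCons algebra_simps power_mult_distrib m[simplified])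
  moreover have "of_nat p dvd ([:a:] ^ p - [:a:])"
    using fermat_int[OF assms, of a] unfolding c by (simp add: of_nat_poly)
  ultimately show ?case
    using pCons freshmans_dream_dvd[OF assms, of "[:a:]" "monom 1 1 * f"]
    by (simp only: dvd_diff dvd_mult)
qed

section \<open>Minimal polynomials over the integers\<close>

text \<open>For an algebraic integer this is the usual minimal polynomial. Generating the annihilator within
  \<^typ>\<open>int poly\<close>, and not only over the rationals, combines minimality of the degree with
  Gauss's lemma; it keeps all later divisions integral.\<close>

definition int_minpoly :: "int poly \<Rightarrow> complex \<Rightarrow> bool" where
  "int_minpoly f z \<longleftrightarrow> lead_coeff f = 1 \<and> (\<forall>g. ipoly g z = 0 \<longleftrightarrow> f dvd g)"

lemma int_minpolyD:
  assumes "int_minpoly f z"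
  shows "lead_coeff f = 1" "ipoly f z = 0" "ipoly g z = 0 \<longleftrightarrow> f dvd g"
  using assms unfolding int_minpoly_def by auto

lemma monic_division_int_poly:
  fixes f g :: "int poly"
  assumes "lead_coeff f = 1"
  obtains q r where "g = f * q + r" "r = 0 \<or> degree r < degree f"
proof -
  obtain q r where qr: "pseudo_divmod g f = (q, r)" by force
  have "f \<noteq> 0" using assms by auto
  from pseudo_divmod[OF this qr] assms that[of q r] show ?thesis by simp
qed

text \<open>Take a primitive annihilator of least degree. Pseudo-division shows that it divides a constant
  multiple of any other annihilator; as its content is 1, the constant divides the content of the
  cofactor and cancels. Being a divisor of the monic polynomial \<open>h\<close>, it has leading coefficient
  \<open>1\<close> or \<open>-1\<close>.\<close>

lemma monic_annihilator_imp_int_minpoly: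
  assumes h: "lead_coeff h = 1" "ipoly h z = 0"
  shows "\<exists>f. int_minpoly f z"
proof -
  define P where "P = (\<lambda>f. f \<noteq> 0 \<and> ipoly f z = 0)"
  have "P h" using h unfolding P_def by auto
  then obtain g where g: "P g" "\<And>f. P f \<Longrightarrow> degree g \<le> degree f"
    using ex_has_least_nat[of P h degree] by blast
  define f where "f = primitive_part g"
  have cg: "content g \<noteq> 0" using g unfolding P_def by simp
  have gf: "g = smult (content g) f" unfolding f_def by simp
  have f0: "f \<noteq> 0" using g gf unfolding P_def by auto
  have df: "degree f = degree g" using cg by (subst gf) simp
  have fz: "ipoly f z = 0"
    using g(1) cg gf unfolding P_def by (metis ipoly_smult mult_eq_0_iff of_int_eq_0_iff)
  have cf: "content f = 1" using g unfolding f_def P_def by simp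
  have dvd: "f dvd u" if u: "ipoly u z = 0" for u
  proof -
    obtain q r where qr: "pseudo_divmod u f = (q, r)" by force
    define c where "c = lead_coeff f ^ (Suc (degree u) - degree f)"
    have c0: "c \<noteq> 0" using f0 unfolding c_def by simp
    have eq: "smult c u = f * q + r" and r: "r = 0 \<or> degree r < degree f"
      using pseudo_divmod[OF f0 qr] unfolding c_def by auto
    have "ipoly r z = 0" using arg_cong[OF eq, of "\<lambda>v. ipoly v z"] u fz by (simp add: ipoly_simps)
    with g(2)[of r] r df have "r = 0" unfolding P_def by fastforce
    with eq have eq: "smult c u = f * q" by simp
    have "[:c:] dvd smult c u" by (simp add: const_poly_dvd_iff)
    hence "c dvd content q" 
      using cf by (simp add: eq const_poly_dvd_iff_dvd_content content_mult)
    hence "[:c:] dvd q" by (simp add: const_poly_dvd_iff_dvd_content)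
    then obtain q' where "q = [:c:] * q'" by (elim dvdE)
    hence "smult c u = smult c (f * q')" using eq by simp
    hence "u = f * q'" using c0 by (simp add: smult_cancel)
    thus ?thesis by simp
  qed
  have "f dvd h" using dvd h by simp
  then obtain k where "h = f * k" by (elim dvdE)
  hence lc: "lead_coeff f * lead_coeff k = 1" using h(1) by (simp add: lead_coeff_mult)
  define f' where "f' = smult (lead_coeff f) f"
  have l2: "lead_coeff f = 1 \<or> lead_coeff f = -1" using lc by (simp add: zmult_eq_1_iff) blast
  have "int_minpoly f' z"
    unfolding int_minpoly_def
  proof (intro conjI allI)
    show "lead_coeff f' = 1" using l2 unfolding f'_def by auto
    show "ipoly u z = 0 \<longleftrightarrow> f' dvd u" for u
      using dvd[of u] l2 ipoly_dvd[of f u z] fz unfolding f'_def by auto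
  qed
  thus ?thesis by blast
qed

lemma degree_monom_minus_one: "n > 0 \<Longrightarrow> degree (monom 1 n - 1 :: int poly) = n"
  using degree_add_eq_left[of "- 1 :: int poly" "monom 1 n"] by (simp add: degree_monom_eq)

lemma root_of_unity_int_minpoly:
  assumes "z ^ n = 1" "n > 0"
  shows "\<exists>f. int_minpoly f z"
proof (rule monic_annihilator_imp_int_minpoly)
  show "lead_coeff (monom 1 n - 1 :: int poly) = 1"
    using degree_monom_minus_one[OF assms(2)] assms(2) by simp
  show "ipoly (monom 1 n - 1) z = 0" using assms by (simp add: ipoly_simps)
qed

lemma int_minpoly_degree_le:
  assumes "int_minpoly f z" "ipoly g z = 0" "g \<noteq> 0"
  shows "degree f \<le> degree g"
  using assms dvd_imp_degree_le int_minpolyD(3) by blast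

section \<open>Galois conjugates of a root of unity\<close>

text \<open>This is Landau's argument. The value of \<open>f\<close> at \<open>z ^ p\<close> is, by \<open>frobenius_int_poly\<close>,
  \<open>p\<close> times an integer combination of \<open>1, z, ..., z ^ (deg f - 1)\<close>, powers that are linearly
  independent. On the other hand it depends only on \<open>p mod n\<close>, so its coordinates stay below a
  bound independent of \<open>p\<close>. Coordinates that are small and divisible by \<open>p\<close> are zero.\<close>

lemma int_minpoly_large_prime:
  assumes f: "int_minpoly f z" and z: "z ^ n = 1" and n: "n > 0"
  shows "\<exists>A. \<forall>p. prime p \<longrightarrow> p > A \<longrightarrow> ipoly f (z ^ p) = 0"
proof -
  note fD = int_minpolyD[OF f]
  have "\<exists>a. (a = 0 \<or> degree a < degree f) \<and> ipoly a z = ipoly f (z ^ r)" for r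
  proof -
    obtain q a where "pcompose f (monom 1 r) = f * q + a" "a = 0 \<or> degree a < degree f"
      by (rule monic_division_int_poly[OF fD(1)])
    thus ?thesis using fD(2) by (metis ipoly_add ipoly_mult ipoly_pcompose_monom add_0 mult_zero_left)
  qed
  then obtain a where a: "\<And>r. a r = 0 \<or> degree (a r) < degree f"
    and az: "\<And>r. ipoly (a r) z = ipoly f (z ^ r)" by metis
  define S where "S = (\<Union>r<n. set (coeffs (a r)))"
  have "finite S" unfolding S_def by auto
  then obtain A where A: "\<And>x. x \<in> S \<Longrightarrow> nat \<bar>x\<bar> \<le> A"
    by (metis finite_imageI finite_nat_set_iff_bounded_le image_eqI)
  show ?thesis
  proof (intro exI[of _ A] allI impI)
    fix p assume p: "prime p" "p > A"
    define r where "r = p mod n"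
    have r: "r < n" using n unfolding r_def by simp
    have zr: "z ^ p = z ^ r"
      using z by (metis r_def div_mult_mod_eq mult.commute mult_1 power_add power_mult power_one)
    obtain h where h: "pcompose f (monom 1 p) - f ^ p = of_nat p * h"
      using frobenius_int_poly[OF p(1), of f] unfolding dvd_def by blast
    obtain q b where b: "h = f * q + b" "b = 0 \<or> degree b < degree f"
      by (rule monic_division_int_poly[OF fD(1)])
    have "ipoly f (z ^ p) = ipoly (smult (int p) b) z"
      using arg_cong[OF h, of "\<lambda>v. ipoly v z"] fD(2) p(1) prime_gt_0_nat[of p]
      by (simp add: ipoly_simps b(1) of_nat_poly power_0_left)
    hence "ipoly (a r - smult (int p) b) z = 0"
      using az[of r] zr by (simp add: ipoly_simps)
    hence dv: "f dvd a r - smult (int p) b" using fD(3) by blast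
    have "a r - smult (int p) b = 0"
    proof (rule ccontr)
      assume ne: "a r - smult (int p) b \<noteq> 0"
      have "degree (a r - smult (int p) b) < degree f"
        using a[of r] b(2) ne degree_diff_less[of "a r" "degree f" "smult (int p) b"] 
        by (cases "a r = 0"; cases "b = 0") (auto intro: le_less_trans[OF degree_smult_le])
      with dvd_imp_degree_le[OF dv ne] show False by simp
    qed
    hence ab: "a r = smult (int p) b" by simp
    have "a r = 0"
    proof (rule ccontr)
      assume ne: "a r \<noteq> 0"
      hence "lead_coeff (a r) \<in> S" using r coeff_in_coeffs[OF ne le_refl] unfolding S_def by blast
      hence "nat \<bar>lead_coeff (a r)\<bar> < p" using A p(2) by fastforce
      moreover have "int p dvd lead_coeff (a r)" unfolding ab by simp
      ultimately have "lead_coeff (a r) = 0"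
        using zdvd_imp_le[of "int p" "\<bar>lead_coeff (a r)\<bar>"] by fastforce
      thus False using ne by simp
    qed
    thus "ipoly f (z ^ p) = 0" using az[of r] zr by simp
  qed
qed

text \<open>If \<open>z ^ p\<close> is a root of the minimal polynomial \<open>f\<close>, then \<open>f\<close> divides \<open>f(X ^ p)\<close>, so
  the roots of \<open>f\<close> are closed under \<open>p\<close>-th powers. Large primes suffice, because the residue
  class of \<open>r\<close> modulo \<open>n\<close> has a representative without small prime factors.\<close>

lemma int_minpoly_coprime_power:
  assumes f: "int_minpoly f z" and z: "z ^ n = 1" and n: "n > 0" and r: "coprime r n"
  shows "ipoly f (z ^ r) = 0"
proof -
  obtain A where A: "\<And>p. prime p \<Longrightarrow> p > A \<Longrightarrow> ipoly f (z ^ p) = 0"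
    using int_minpoly_large_prime[OF f z n] by blast
  have step: "ipoly f (w ^ p) = 0" if "prime p" "p > A" "ipoly f w = 0" for p w
  proof -
    have "f dvd pcompose f (monom 1 p)"
      using A[OF that(1,2)] int_minpolyD(3)[OF f] by (metis ipoly_pcompose_monom)
    from ipoly_dvd[OF this that(3)] show ?thesis by (simp add: ipoly_simps)
  qed
  have all: "ipoly f (z ^ s) = 0" if "s > 0" "\<And>p. prime p \<Longrightarrow> p dvd s \<Longrightarrow> p > A" for s
    using that
  proof (induct s rule: prime_divisors_induct)
    case (factor p s)
    have "ipoly f (z ^ s) = 0" using factor by (intro factor) auto
    hence "ipoly f ((z ^ s) ^ p) = 0" using step[of p "z ^ s"] factor by auto
    thus ?case by (simp add: power_mult[symmetric] mult.commute)
  qed (use int_minpolyD(2)[OF f] in auto)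
  \<comment> \<open>A prime up to \<^term>\<open>A\<close> divides exactly one of \<^term>\<open>r\<close> and \<open>n * Q\<close>, hence does not
    divide their sum.\<close>
  define Q where "Q = \<Prod>{q. prime q \<and> q \<le> A \<and> \<not> q dvd r}"
  have fin: "finite {q::nat. prime q \<and> q \<le> A \<and> \<not> q dvd r}" by simp
  have "ipoly f (z ^ (r + n * Q)) = 0"
  proof (rule all)
    have "Q > 0" unfolding Q_def by (intro prod_pos) (auto intro: prime_gt_0_nat)
    thus "r + n * Q > 0" using n by simp
    fix p assume p: "prime p" "p dvd r + n * Q"
    show "p > A"
    proof (rule ccontr)
      assume "\<not> p > A"
      hence pA: "p \<le> A" by simp
      show False
      proof (cases "p dvd r")
        case True
        hence "\<not> p dvd n" using r p(1) by (meson coprime_common_divisor_nat not_prime_unit coprime_def)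
        moreover have "\<not> p dvd Q" unfolding Q_def
        proof
          assume "p dvd \<Prod>{q. prime q \<and> q \<le> A \<and> \<not> q dvd r}"
          then obtain q where "prime q" "\<not> q dvd r" "p dvd q"
            using prime_dvd_prod_iff[OF fin p(1), of "\<lambda>x. x"] by auto
          with True p(1) show False using primes_dvd_imp_eq by blast
        qed
        ultimately show False using p True by (simp add: dvd_add_right_iff prime_dvd_mult_iff)
      next
        case False
        hence "p dvd Q" unfolding Q_def using fin p pA by (intro dvd_prodI[of _ _ "\<lambda>x. x"]) auto
        thus False using p False by (simp add: dvd_add_left_iff)
      qed
    qed
  qed
  moreover have "z ^ (r + n * Q) = z ^ r" using z by (simp add: power_add power_mult)
  ultimately show ?thesis by simp
qed

section \<open>The degree of the minimal polynomial of a primitive root of unity\<close>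

lemma primitive_root_power_eq_iff:
  fixes z :: complex
  assumes n: "n > 0" and prim: "\<And>k. z ^ k = 1 \<longleftrightarrow> n dvd k"
  shows "z ^ j = z ^ k \<longleftrightarrow> [j = k] (mod n)"
proof -
  have z0: "z \<noteq> 0" using prim[of n] n by (auto simp: power_0_left)
  have le: "z ^ j = z ^ k \<longleftrightarrow> [j = k] (mod n)" if "j \<le> k" for j k
  proof -
    have "z ^ k = z ^ j * z ^ (k - j)" using that by (simp flip: power_add)
    hence "z ^ j = z ^ k \<longleftrightarrow> z ^ (k - j) = 1" using z0 by auto
    also have "\<dots> \<longleftrightarrow> [j = k] (mod n)"
      using that by (simp add: prim cong_altdef_nat cong_sym_eq[of j])
    finally show ?thesis .
  qed
  show ?thesis using le[of j k] le[of k j] by (metis cong_sym nle_le)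
qed

lemma root_of_unity_is_primitive_power:
  fixes z :: complex
  assumes n: "n > 0" and prim: "\<And>k. z ^ k = 1 \<longleftrightarrow> n dvd k" and w: "w ^ n = 1"
  obtains j where "j < n" "w = z ^ j"
proof -
  have zn: "z ^ n = 1" using prim by simp
  have inj: "inj_on (\<lambda>j. z ^ j) {..<n}"
    using cong_less_modulus_unique_nat
    by (auto simp: inj_on_def primitive_root_power_eq_iff[OF n prim])
  have sub: "(\<lambda>j. z ^ j) ` {..<n} \<subseteq> {w. w ^ n = 1}"
    using zn by (auto simp: power_commutes simp flip: power_mult) (metis mult.commute power_mult power_one)
  have "(\<lambda>j. z ^ j) ` {..<n} = {w. w ^ n = 1}"
    using inj sub n by (intro card_subset_eq finite_roots_unity) (auto simp: card_image card_roots_unity_eq)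
  hence "w \<in> (\<lambda>j. z ^ j) ` {..<n}" using w by auto
  thus ?thesis using that by auto
qed

text \<open>Otherwise the conjugate \<open>z ^ j\<close> would be a root of unity of smaller order \<open>m\<close>. Its minimal
  polynomial divides both \<open>f\<close> and \<open>X ^ m - 1\<close>; irreducibility of \<open>f\<close> then forces
  \<open>z ^ m = 1\<close>.\<close>

lemma int_minpoly_root_coprime:
  assumes n: "n > 0" and prim: "\<And>k. z ^ k = 1 \<longleftrightarrow> n dvd k"
    and f: "int_minpoly f z" and w: "ipoly f (z ^ j) = 0"
  shows "coprime j n"
proof (rule ccontr)
  assume nc: "\<not> coprime j n"
  define m where "m = n div gcd j n"
  have g: "gcd j n > 1" using nc n by (metis coprime_iff_gcd_eq_1 gcd_pos_nat less_one linorder_neqE_nat not_gr_zero)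
  have m: "m > 0" "m < n" using g n unfolding m_def by (auto simp: div_greater_zero_iff gcd_le2_nat)
  have "n dvd j * m" unfolding m_def by (metis dvd_triv_right div_mult_swap dvd_div_mult gcd_dvd1 gcd_dvd2 mult.commute)
  hence wm: "(z ^ j) ^ m = 1" by (simp add: prim flip: power_mult)
  obtain f' where f': "int_minpoly f' (z ^ j)" using root_of_unity_int_minpoly[OF wm m(1)] by blast
  obtain u where u: "f = f' * u" using int_minpolyD(3)[OF f'] w by (auto elim: dvdE)
  have f0: "f \<noteq> 0" using int_minpolyD(1)[OF f] by auto
  \<comment> \<open>The root \<^term>\<open>z\<close> of \<^term>\<open>f\<close> belongs to the factor \<^term>\<open>f'\<close>, as \<^term>\<open>u\<close> has
    smaller degree than \<^term>\<open>f\<close>.\<close>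
  have "ipoly u z \<noteq> 0"
  proof
    assume "ipoly u z = 0"
    hence "degree f \<le> degree u" using f u f0 by (intro int_minpoly_degree_le) auto
    hence "degree f' = 0" using u f0 by (simp add: degree_mult_eq)
    hence "f' = 1" using int_minpolyD(1)[OF f'] by (metis degree_eq_zeroE lead_coeff_pCons(2) one_pCons)
    thus False using int_minpolyD(2)[OF f'] by simp
  qed
  hence "ipoly f' z = 0" using int_minpolyD(2)[OF f] u by (simp add: ipoly_mult)
  moreover have "f' dvd monom 1 m - 1"
    using wm int_minpolyD(3)[OF f'] by (metis ipoly_diff ipoly_monom ipoly_power power_0 right_minus_eq)
  ultimately have "z ^ m = 1" using ipoly_dvd[of f' "monom 1 m - 1" z] by (simp add: ipoly_diff ipoly_monom)
  thus False using prim m by (auto dest: dvd_imp_le)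
qed

text \<open>The complex roots of \<open>f\<close> are exactly the powers of \<open>z\<close> with exponent coprime to \<open>n\<close>, by
  \<open>int_minpoly_coprime_power\<close> and \<open>int_minpoly_root_coprime\<close>, and they are simple because
  \<open>X ^ n - 1\<close> has \<open>n\<close> distinct roots.\<close>

lemma degree_int_minpoly_primitive_root:
  assumes n: "n > 0" and prim: "\<And>k. z ^ k = 1 \<longleftrightarrow> n dvd k" and f: "int_minpoly f z"
  shows "degree f = totient n"
proof -
  have zn: "z ^ n = 1" using prim by simp
  have f0: "f \<noteq> 0" using int_minpolyD(1)[OF f] by auto
  define P :: "int poly" where "P = monom 1 n - 1"
  have Pw: "ipoly P w = w ^ n - 1" for w unfolding P_def by (simp add: ipoly_diff ipoly_monom)
  have dP: "degree P = n" unfolding P_def by (rule degree_monom_minus_one[OF n])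
  have P0: "P \<noteq> 0" using dP n by auto
  have "f dvd P" using int_minpolyD(3)[OF f, of P] Pw zn by simp
  then obtain q where q: "P = f * q" by (elim dvdE)
  have q0: "q \<noteq> 0" using q P0 by auto
  have roots: "card {w. ipoly h w = 0} \<le> degree h" if "h \<noteq> 0" for h
  proof -
    have "map_poly of_int h \<noteq> (0 :: complex poly)" using that by (simp add: map_poly_eq_0_iff)
    from card_poly_roots_bound[OF this] show ?thesis by (simp add: degree_map_poly)
  qed
  \<comment> \<open>The \<^term>\<open>n\<close> roots of \<^term>\<open>P\<close> are shared out between \<^term>\<open>f\<close> and
    \<^term>\<open>q\<close>, whose degrees add up to \<^term>\<open>n\<close>; so \<^term>\<open>f\<close> must have as many roots as
    its degree allows.\<close>
  have "{w. w ^ n = 1} = {w. ipoly f w = 0} \<union> {w. ipoly q w = 0}"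
    using Pw unfolding q by (auto simp: ipoly_mult) (metis mult_eq_0_iff right_minus_eq)+
  hence "n \<le> card {w. ipoly f w = 0} + card {w. ipoly q w = 0}"
    using card_roots_unity_eq[OF n] card_Un_le by metis
  moreover have "n = degree f + degree q" using dP q f0 q0 by (simp add: degree_mult_eq)
  ultimately have df: "degree f = card {w. ipoly f w = 0}"
    using roots[OF f0] roots[OF q0] by linarith
  have "bij_betw (\<lambda>r. z ^ r) (totatives n) {w. ipoly f w = 0}"
    unfolding bij_betw_def
  proof (intro conjI subset_antisym subsetI)
    show "inj_on (\<lambda>r. z ^ r) (totatives n)"
    proof (rule inj_onI)
      fix j k assume jk: "j \<in> totatives n" "k \<in> totatives n" "z ^ j = z ^ k"
      hence c: "[j = k] (mod n)" using primitive_root_power_eq_iff[OF n prim] by simp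
      show "j = k"
      proof (cases "n = 1")
        case False
        hence "j < n" "k < n" using jk totatives_less[of _ n] n by auto
        thus ?thesis using c by (simp add: cong_less_modulus_unique_nat)
      qed (use jk in auto)
    qed
    show "w \<in> {w. ipoly f w = 0}" if "w \<in> (\<lambda>r. z ^ r) ` totatives n" for w
      using that int_minpoly_coprime_power[OF f zn n] by (auto simp: in_totatives_iff)
    fix w assume w: "w \<in> {w. ipoly f w = 0}"
    hence "w ^ n = 1" using Pw[of w] q by (simp add: ipoly_mult)
    then obtain j where j: "j < n" "w = z ^ j"
      using root_of_unity_is_primitive_power[OF n prim] by blast
    have c: "coprime j n" using int_minpoly_root_coprime[OF n prim f] w j by simp
    show "w \<in> (\<lambda>r. z ^ r) ` totatives n"
    proof (cases "j = 0")
      case True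
      hence "n = 1" using c by simp
      thus ?thesis using zn j True by simp
    next
      case False
      thus ?thesis using c j by (auto simp: in_totatives_iff)
    qed
  qed
  thus ?thesis unfolding df totient_def by (simp add: bij_betw_same_card)
qed

section \<open>Subfields of the complex numbers\<close>

interpretation CF: domain complex_field
  using field.axioms(1)[OF field_from_type_algebra] .

lemma complex_field_simps [simp]:
  "carrier complex_field = UNIV" "x \<oplus>\<^bsub>complex_field\<^esub> y = x + y"
  "x \<otimes>\<^bsub>complex_field\<^esub> y = x * y" "\<zero>\<^bsub>complex_field\<^esub> = 0" "\<one>\<^bsub>complex_field\<^esub> = 1"
  by (simp_all add: ring_of_type_algebra_def)

lemma complex_field_a_inv [simp]: "\<ominus>\<^bsub>complex_field\<^esub> x = - x"
  by (rule CF.minus_equality) simp_all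

lemma complex_field_inv: "x \<noteq> 0 \<Longrightarrow> inv\<^bsub>complex_field\<^esub> x = inverse x"
  by (rule CF.comm_inv_char) simp_all

lemma subfieldD:
  assumes "subfield K complex_field"
  shows "0 \<in> K" "1 \<in> K" "x \<in> K \<Longrightarrow> y \<in> K \<Longrightarrow> x + y \<in> K" "x \<in> K \<Longrightarrow> y \<in> K \<Longrightarrow> x * y \<in> K"
    "x \<in> K \<Longrightarrow> - x \<in> K" "x \<in> K \<Longrightarrow> inverse x \<in> K" "x \<in> K \<Longrightarrow> y \<in> K \<Longrightarrow> x - y \<in> K"
    "x \<in> K \<Longrightarrow> y \<in> K \<Longrightarrow> x / y \<in> K"
proof -
  note R = subfieldE(1)[OF assms]
  show "0 \<in> K" "1 \<in> K" using subringE(2,3)[OF R] by auto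
  show add: "x \<in> K \<Longrightarrow> y \<in> K \<Longrightarrow> x + y \<in> K" for x y using subringE(7)[OF R, of x y] by simp
  show mult: "x \<in> K \<Longrightarrow> y \<in> K \<Longrightarrow> x * y \<in> K" for x y using subringE(6)[OF R, of x y] by simp
  show minus: "x \<in> K \<Longrightarrow> - x \<in> K" for x using subringE(5)[OF R, of x] by simp
  show inv: "x \<in> K \<Longrightarrow> inverse x \<in> K" for x
    using CF.subfield_m_inv(1)[OF assms, of x] \<open>0 \<in> K\<close> by (cases "x = 0") (auto simp: complex_field_inv)
  show "x \<in> K \<Longrightarrow> y \<in> K \<Longrightarrow> x - y \<in> K" using add[of x "- y"] minus[of y] by simp
  show "x \<in> K \<Longrightarrow> y \<in> K \<Longrightarrow> x / y \<in> K" using mult[of x "inverse y"] inv[of y] by (simp add: divide_inverse)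
qed

lemma subfield_prod: "subfield K complex_field \<Longrightarrow> (\<And>i. i \<in> I \<Longrightarrow> f i \<in> K) \<Longrightarrow> prod f I \<in> K"
  by (induct I rule: infinite_finite_induct) (auto simp: subfieldD)

lemma subfield_power: "subfield K complex_field \<Longrightarrow> x \<in> K \<Longrightarrow> x ^ k \<in> K"
  by (induct k) (auto simp: subfieldD)

lemma subfield_Rats: "subfield \<rat> complex_field"
proof (rule field.subfieldI'[OF field_from_type_algebra])
  show "subring \<rat> complex_field" by (rule CF.subringI) auto
  show "inv\<^bsub>complex_field\<^esub> k \<in> \<rat>" if "k \<in> \<rat> - {\<zero>\<^bsub>complex_field\<^esub>}" for k
    using that by (auto simp: complex_field_inv)
qed

abbreviation adjoin :: "complex set \<Rightarrow> complex set \<Rightarrow> complex set" where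
  "adjoin K S \<equiv> generate_field complex_field (K \<union> S)"

lemma subfield_adjoin: "subfield (adjoin K S) complex_field"
  by (rule field.generate_field_is_subfield[OF field_from_type_algebra]) simp

lemma adjoin_incl: "K \<subseteq> adjoin K S" "S \<subseteq> adjoin K S"
  by (auto intro: generate_field.incl)

lemma adjoin_minimal: "subfield L complex_field \<Longrightarrow> K \<subseteq> L \<Longrightarrow> S \<subseteq> L \<Longrightarrow> adjoin K S \<subseteq> L"
  by (rule field.generate_field_min_subfield1[OF field_from_type_algebra]) auto

lemma adjoin_adjoin: "adjoin (adjoin K A) B = adjoin K (A \<union> B)"
proof
  show "adjoin (adjoin K A) B \<subseteq> adjoin K (A \<union> B)"
    by (intro adjoin_minimal subfield_adjoin) (auto intro: generate_field.incl)
  show "adjoin K (A \<union> B) \<subseteq> adjoin (adjoin K A) B"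
    by (intro adjoin_minimal subfield_adjoin) (auto intro: generate_field.incl)
qed

section \<open>The degree of a simple extension\<close>

definition power_span :: "complex set \<Rightarrow> complex \<Rightarrow> nat \<Rightarrow> complex set" where
  "power_span K z d = {\<Sum>i<d. c i * z ^ i | c. \<forall>i. c i \<in> K}"

lemma power_spanI: "(\<And>i. c i \<in> K) \<Longrightarrow> x = (\<Sum>i<d. c i * z ^ i) \<Longrightarrow> x \<in> power_span K z d"
  unfolding power_span_def by blast

lemma power_spanE:
  assumes "x \<in> power_span K z d"
  obtains c where "\<And>i. c i \<in> K" "x = (\<Sum>i<d. c i * z ^ i)"
  using assms unfolding power_span_def by blast

lemma line_extension_power_span:
  "CF.line_extension K (z ^ m) (power_span K z m) = power_span K z (Suc m)"
proof -
  have "CF.line_extension K (z ^ m) (power_span K z m) =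
      {k * z ^ m + e | k e. k \<in> K \<and> e \<in> power_span K z m}"
    unfolding CF.line_extension_def set_add_def' r_coset_def by auto
  also have "\<dots> = power_span K z (Suc m)"
  proof (intro subset_antisym subsetI)
    fix x assume "x \<in> {k * z ^ m + e | k e. k \<in> K \<and> e \<in> power_span K z m}"
    then obtain k c where "k \<in> K" "\<And>i. c i \<in> K" "x = k * z ^ m + (\<Sum>i<m. c i * z ^ i)"
      by (auto elim!: power_spanE)
    thus "x \<in> power_span K z (Suc m)" by (intro power_spanI[of "c(m := k)"]) auto
  next
    fix x assume "x \<in> power_span K z (Suc m)"
    then obtain c where "\<And>i. c i \<in> K" "x = c m * z ^ m + (\<Sum>i<m. c i * z ^ i)"
      by (elim power_spanE) (auto simp: add.commute)
    moreover from this have "(\<Sum>i<m. c i * z ^ i) \<in> power_span K z m" by (intro power_spanI) auto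
    ultimately show "x \<in> {k * z ^ m + e | k e. k \<in> K \<and> e \<in> power_span K z m}" by blast
  qed
  finally show ?thesis .
qed

lemma dimension_power_span:
  assumes K: "subfield K complex_field"
    and indep: "\<And>c. (\<And>i. c i \<in> K) \<Longrightarrow> (\<Sum>i<d. c i * z ^ i) = 0 \<Longrightarrow> \<forall>i<d. c i = 0"
  shows "m \<le> d \<Longrightarrow> CF.dimension m K (power_span K z m)"
proof (induct m)
  case 0
  have "power_span K z 0 = {0}" unfolding power_span_def using subfieldD(1)[OF K] by auto
  thus ?case using CF.zero_dim[of K] by simp
next
  case (Suc m)
  have "z ^ m \<notin> power_span K z m"
  proof
    assume "z ^ m \<in> power_span K z m"
    then obtain c where c: "\<And>i. c i \<in> K" "z ^ m = (\<Sum>i<m. c i * z ^ i)" by (rule power_spanE) blast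
    define b where "b = (\<lambda>i. if i < m then c i else if i = m then -1 else 0)"
    have bK: "b i \<in> K" for i unfolding b_def using c(1) subfieldD[OF K] by auto
    have "(\<Sum>i<d. b i * z ^ i) = (\<Sum>i<Suc m. b i * z ^ i)"
      using Suc.prems by (intro sum.mono_neutral_right) (auto simp: b_def)
    also have "\<dots> = 0" using c(2) by (simp add: b_def)
    finally have "(\<Sum>i<d. b i * z ^ i) = 0" .
    from indep[of b, OF bK this] have "b m = 0" using Suc.prems by auto
    thus False by (simp add: b_def)
  qed
  thus ?case using CF.Suc_dim[of "z ^ m" "power_span K z m" m K] Suc
    by (simp add: line_extension_power_span)
qed

lemma adjoin_eq_simple_extension:
  assumes K: "subfield K complex_field" and alg: "(CF.algebraic over K) z"
  shows "adjoin K {z} = CF.simple_extension K z"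
proof
  have "subfield (CF.simple_extension K z) complex_field"
    using CF.simple_extension_is_subfield[OF K] alg by simp
  moreover have "z \<in> CF.simple_extension K z" using CF.simple_extension_mem[OF subfieldE(1)[OF K]] by simp
  moreover have "K \<subseteq> CF.simple_extension K z" by (rule CF.simple_extension_incl) auto
  ultimately show "adjoin K {z} \<subseteq> CF.simple_extension K z" by (intro adjoin_minimal) auto
  show "CF.simple_extension K z \<subseteq> adjoin K {z}"
    by (rule CF.simple_extension_subring_incl[OF subfieldE(1)[OF subfield_adjoin] adjoin_incl(1)])
       (use adjoin_incl(2) in blast)
qed

text \<open>Since \<open>z ^ d\<close> is a combination of lower powers, the span of \<open>1, z, ..., z ^ (d - 1)\<close> is stable
  under multiplication by \<open>z\<close> and so equals \<open>K[z]\<close>. As this ring has finite dimension over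
  \<open>K\<close>, the element \<open>z\<close> is algebraic and \<open>K[z]\<close> is already a field.\<close>

lemma simple_extension_degree:
  assumes K: "subfield K complex_field"
    and span: "z ^ d \<in> power_span K z d"
    and indep: "\<And>c. (\<And>i. c i \<in> K) \<Longrightarrow> (\<Sum>i<d. c i * z ^ i) = 0 \<Longrightarrow> \<forall>i<d. c i = 0"
  shows "CF.dimension d K (adjoin K {z})" "adjoin K {z} = power_span K z d"
proof -
  have KR: "subring K complex_field" using subfieldE(1)[OF K] .
  have "d \<noteq> 0"
  proof
    assume "d = 0"
    thus False using span by (auto elim!: power_spanE)
  qed
  then obtain e where e: "d = Suc e" by (cases d) auto
  obtain b where b: "\<And>i. b i \<in> K" "z ^ d = (\<Sum>i<d. b i * z ^ i)" using span by (rule power_spanE) blast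
  have 1: "CF.simple_extension K z \<subseteq> power_span K z d"
  proof
    fix x assume "x \<in> CF.simple_extension K z"
    thus "x \<in> power_span K z d"
    proof (induct rule: CF.simple_extension.induct)
      case zero
      show ?case using subfieldD(1)[OF K] by (intro power_spanI[of "\<lambda>_. 0"]) auto
    next
      case (lin k1 k2)
      obtain c where c: "\<And>i. c i \<in> K" "k1 = (\<Sum>i<d. c i * z ^ i)" using lin(2) by (rule power_spanE) blast
      \<comment> \<open>Multiplication by \<^term>\<open>z\<close> shifts the coefficients; the one that overflows to
        \<^term>\<open>z ^ d\<close> is spread out again by \<^term>\<open>b\<close>.\<close>
      define a where "a = (\<lambda>i. (if i = 0 then k2 else c (i - 1)) + c e * b i)"
      have "k1 * z + k2 = (\<Sum>i<e. c i * z ^ Suc i) + k2 + c e * z ^ d"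
        unfolding c(2) e by (simp add: sum_distrib_left algebra_simps)
      also have "\<dots> = (\<Sum>i<d. (if i = 0 then k2 else c (i - 1)) * z ^ i) + (\<Sum>i<d. c e * b i * z ^ i)"
        unfolding b(2) unfolding e sum.lessThan_Suc_shift by (simp add: sum_distrib_left algebra_simps)
      also have "\<dots> = (\<Sum>i<d. a i * z ^ i)" by (simp add: a_def algebra_simps sum.distrib)
      finally show ?case using c b lin(3) by (intro power_spanI[of a]) (auto simp: a_def subfieldD[OF K])
    qed
  qed
  have S: "subring (CF.simple_extension K z) complex_field"
    using CF.simple_extension_is_subring[OF KR] by simp
  have zS: "z \<in> CF.simple_extension K z" using CF.simple_extension_mem[OF KR] by simp
  have KS: "K \<subseteq> CF.simple_extension K z" by (rule CF.simple_extension_incl) auto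
  have "\<And>i. z ^ i \<in> CF.simple_extension K z"
  proof -
    fix i show "z ^ i \<in> CF.simple_extension K z"
      using subringE(3)[OF S] subringE(6)[OF S zS] by (induct i) auto
  qed
  hence 2: "power_span K z d \<subseteq> CF.simple_extension K z"
  proof (intro subsetI, elim power_spanE)
    fix x c assume c: "\<And>i. z ^ i \<in> CF.simple_extension K z" "\<And>i. c i \<in> K" "x = (\<Sum>i<d. c i * z ^ i)"
    have "c i \<in> CF.simple_extension K z" for i using c(2) KS by blast
    hence "(\<Sum>i<m. c i * z ^ i) \<in> CF.simple_extension K z" for m
      using subringE(2)[OF S] subringE(7)[OF S] subringE(6)[OF S] c(1) by (induct m) auto
    thus "x \<in> CF.simple_extension K z" using c by simp
  qed
  have eq: "CF.simple_extension K z = power_span K z d" using 1 2 by blast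
  have dim: "CF.dimension d K (power_span K z d)" by (rule dimension_power_span[OF K indep]) auto
  have alg: "(CF.algebraic over K) z"
    using CF.finite_dimension_simple_extension[OF K, of z] CF.finite_dimensionI[OF dim] eq by simp
  have "adjoin K {z} = CF.simple_extension K z" using adjoin_eq_simple_extension[OF K alg] .
  thus "adjoin K {z} = power_span K z d" "CF.dimension d K (adjoin K {z})" using eq dim by auto
qed

section \<open>Multiquadratic extensions\<close>

lemma quadratic_extension:
  assumes K: "subfield K complex_field" and a: "a \<notin> K" "a\<^sup>2 \<in> K"
  shows "CF.dimension 2 K (adjoin K {a})"
    and "x \<in> adjoin K {a} \<Longrightarrow> \<exists>u\<in>K. \<exists>v\<in>K. x = u + v * a"
proof -
  have span: "a ^ 2 \<in> power_span K a 2"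
    using a subfieldD(1)[OF K] by (intro power_spanI[of "\<lambda>i. if i = 0 then a\<^sup>2 else 0"]) (auto simp: numeral_2_eq_2)
  have indep: "\<forall>i<2. c i = 0" if c: "\<And>i. c i \<in> K" "(\<Sum>i<2. c i * a ^ i) = 0" for c
  proof -
    have eq: "c 0 + c 1 * a = 0" using c(2) by (simp add: numeral_2_eq_2)
    have "c 1 = 0"
    proof (rule ccontr)
      assume "c 1 \<noteq> 0"
      hence "a = - c 0 / c 1" using eq by (simp add: field_simps add_eq_0_iff)
      thus False using a(1) c(1) subfieldD[OF K] by metis
    qed
    with eq show ?thesis by (auto simp: less_2_cases_iff)
  qed
  note * = simple_extension_degree[OF K span indep]
  show "CF.dimension 2 K (adjoin K {a})" using *(1) by blast
  show "\<exists>u\<in>K. \<exists>v\<in>K. x = u + v * a" if "x \<in> adjoin K {a}"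
  proof -
    have "x \<in> power_span K a 2" using that *(2) by blast
    then obtain c where "\<And>i. c i \<in> K" "x = (\<Sum>i<2. c i * a ^ i)" by (rule power_spanE) blast
    thus ?thesis by (intro bexI[of _ "c 0"] bexI[of _ "c 1"]) (auto simp: numeral_2_eq_2)
  qed
qed

text \<open>The extension is a tower of quadratic steps. For the induction, after adjoining one root \<open>a\<close> no
  product \<open>t\<close> of the others may become an element of \<open>K(a)\<close>. If \<open>t = u + v * a\<close>, squaring
  expresses \<open>2 * u * v * a\<close> through elements of \<open>K\<close>; as \<open>a\<close> is not in \<open>K\<close>, this gives
  \<open>u = 0\<close> or \<open>v = 0\<close>, and one of the products \<open>a * t\<close> and \<open>t\<close> lies in \<open>K\<close>, contrary to the hypothesis on products.\<close>

lemma multiquadratic_degree: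
  assumes "finite S" "subfield K complex_field" "\<And>s. s \<in> S \<Longrightarrow> s\<^sup>2 \<in> K"
    and "\<And>T. T \<subseteq> S \<Longrightarrow> T \<noteq> {} \<Longrightarrow> \<Prod>T \<notin> K"
  shows "CF.dimension (2 ^ card S) K (adjoin K S)"
  using assms
proof (induct S arbitrary: K rule: finite_induct)
  case empty
  have "adjoin K {} = K" using empty adjoin_incl[of K "{}"] adjoin_minimal[of K K "{}"] by auto
  thus ?case using CF.dimension_one[OF empty(1)] by simp
next
  case (insert a S)
  note K = insert.prems(1)
  have aK: "a \<notin> K" "a\<^sup>2 \<in> K" using insert.prems(3)[of "{a}"] insert.prems(2)[of a] by auto
  define F where "F = adjoin K {a}"
  have F: "subfield F complex_field" unfolding F_def by (rule subfield_adjoin)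
  have KF: "K \<subseteq> F" unfolding F_def by (rule adjoin_incl)
  have "CF.dimension (2 ^ card S) F (adjoin F S)"
  proof (rule insert.hyps(3)[OF F])
    show "s\<^sup>2 \<in> F" if "s \<in> S" for s using insert.prems(2)[of s] that KF by auto
    fix T assume T: "T \<subseteq> S" "T \<noteq> {}"
    define t where "t = \<Prod>T"
    have finT: "finite T" using T(1) insert.hyps(1) finite_subset by blast
    have tK: "t \<notin> K" unfolding t_def using insert.prems(3)[of T] T by auto
    have "\<Prod>(insert a T) \<notin> K" using insert.prems(3)[of "insert a T"] T by auto
    moreover have "\<Prod>(insert a T) = a * t"
      using finT insert.hyps(2) T(1) unfolding t_def by (subst prod.insert) auto
    ultimately have atK: "a * t \<notin> K" by simp
    have t2: "t\<^sup>2 \<in> K"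
      unfolding t_def prod_power_distrib using T(1) insert.prems(2) by (intro subfield_prod[OF K]) auto
    show "\<Prod>T \<notin> F"
    proof
      assume "\<Prod>T \<in> F"
      then obtain u v where uv: "u \<in> K" "v \<in> K" "t = u + v * a"
        using quadratic_extension(2)[OF K aK] unfolding F_def t_def by blast
      have v0: "v \<noteq> 0" using uv tK by auto
      have u0: "u \<noteq> 0" 
      proof
        assume "u = 0"
        hence "a * t = v * a\<^sup>2" using uv(3) by (simp add: power2_eq_square)
        thus False using atK uv(2) aK(2) subfieldD(4)[OF K] by simp
      qed
      have "a = (t\<^sup>2 - u\<^sup>2 - v\<^sup>2 * a\<^sup>2) / ((1 + 1) * u * v)"
        using u0 v0 unfolding uv(3) by (simp add: field_simps power2_eq_square)
      also have "\<dots> \<in> K"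
      proof -
        have "1 + 1 \<in> K" "u\<^sup>2 \<in> K" "v\<^sup>2 \<in> K"
          using uv(1,2) by (simp_all only: subfieldD[OF K] subfield_power[OF K])
        thus ?thesis using t2 uv(1,2) aK(2) by (simp only: subfieldD[OF K])
      qed
      finally show False using aK(1) by simp
    qed
  qed
  hence "CF.dimension (2 * 2 ^ card S) K (adjoin F S)"
    using CF.telescopic_base[OF K F quadratic_extension(1)[OF K aK, folded F_def]] by blast
  moreover have "adjoin F S = adjoin K (insert a S)" unfolding F_def adjoin_adjoin by simp
  ultimately show ?case using insert.hyps by simp
qed

section \<open>The cyclotomic field over the rationals\<close>

lemma Rats_common_denominator:
  fixes c :: "nat \<Rightarrow> complex"
  assumes "\<And>i. c i \<in> \<rat>"
  obtains D :: int and b :: "nat \<Rightarrow> int" where "D \<noteq> 0" "\<And>i. i < d \<Longrightarrow> of_int D * c i = of_int (b i)"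
proof -
  have "\<exists>p q. q \<noteq> 0 \<and> c i * of_int q = of_int p" for i
  proof -
    obtain a b :: int where b: "b > 0" "c i = of_int a / of_int b"
      by (rule Rats_cases'[OF assms[of i]])
    have "c i * of_int b = of_int a" using b by simp
    thus ?thesis using b(1) by (intro exI[of _ a] exI[of _ b] conjI) simp_all
  qed
  then obtain p q where q: "\<And>i. q i \<noteq> (0::int)" and pq: "\<And>i. c i * of_int (q i) = of_int (p i)"
    by metis
  have "of_int (\<Prod>j<d. q j) * c i = of_int (p i * (\<Prod>j\<in>{..<d} - {i}. q j))" if "i < d" for i
  proof -
    have "(\<Prod>j<d. q j) = q i * (\<Prod>j\<in>{..<d} - {i}. q j)" using that by (intro prod.remove) auto
    hence "of_int (\<Prod>j<d. q j) * c i = (c i * of_int (q i)) * of_int (\<Prod>j\<in>{..<d} - {i}. q j)"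
      by (simp only: of_int_mult mult_ac)
    thus ?thesis by (simp only: pq of_int_mult)
  qed
  moreover have "(\<Prod>j<d. q j) \<noteq> 0" using q by simp
  ultimately show ?thesis
    by (intro that[of "\<Prod>j<d. q j" "\<lambda>i. p i * (\<Prod>j\<in>{..<d} - {i}. q j)"])
qed

text \<open>The minimal polynomial \<open>f\<close> expresses \<open>z ^ deg f\<close> by lower powers, and a rational relation
  among the lower powers becomes, after clearing denominators, an integer polynomial of degree less
  than that of \<open>f\<close> with root \<open>z\<close>.\<close>

lemma cyclotomic_degree:
  assumes n: "n > 0" and prim: "\<And>k. z ^ k = 1 \<longleftrightarrow> n dvd k"
  shows "CF.dimension (totient n) \<rat> (adjoin \<rat> {z})"
proof -
  have "z ^ n = 1" using prim by simp
  then obtain f where f: "int_minpoly f z" using root_of_unity_int_minpoly n by blast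
  define d where "d = degree f"
  have d: "d = totient n" unfolding d_def by (rule degree_int_minpoly_primitive_root[OF n prim f])
  have ev: "ipoly g z = (\<Sum>i\<le>degree g. of_int (coeff g i) * z ^ i)" for g
    by (simp add: poly_altdef degree_map_poly coeff_map_poly)
  have lc: "coeff f d = 1" using int_minpolyD(1)[OF f] unfolding d_def .
  have "0 = (\<Sum>i\<le>d. of_int (coeff f i) * z ^ i)" using ev[of f] int_minpolyD(2)[OF f] unfolding d_def by simp
  also have "\<dots> = z ^ d + (\<Sum>i<d. of_int (coeff f i) * z ^ i)"
    using lc by (simp add: lessThan_Suc_atMost[symmetric])
  finally have "z ^ d = (\<Sum>i<d. of_int (- coeff f i) * z ^ i)"
    by (simp add: sum_negf eq_neg_iff_add_eq_0)
  hence span: "z ^ d \<in> power_span \<rat> z d" by (intro power_spanI[of "\<lambda>i. of_int (- coeff f i)"]) auto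
  have indep: "\<forall>i<d. c i = 0" if c: "\<And>i. c i \<in> \<rat>" "(\<Sum>i<d. c i * z ^ i) = 0" for c
  proof -
    obtain D b where D: "D \<noteq> 0" "\<And>i. i < d \<Longrightarrow> of_int D * c i = of_int (b i)"
      using Rats_common_denominator[of c d] c(1) by blast
    define g where "g = (\<Sum>i<d. monom (b i) i)"
    have cg: "coeff g i = (if i < d then b i else 0)" for i
      unfolding g_def by (simp add: coeff_sum)
    have "ipoly g z = (\<Sum>i<d. of_int (coeff g i) * z ^ i)"
      unfolding ev by (rule sum.mono_neutral_cong) (auto simp: cg coeff_eq_0 intro: le_degree)
    also have "\<dots> = of_int D * (\<Sum>i<d. c i * z ^ i)"
      unfolding sum_distrib_left by (intro sum.cong) (auto simp: cg D(2)[symmetric])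
    finally have gz: "ipoly g z = 0" using c(2) by simp
    have "g = 0"
    proof (rule ccontr)
      assume g0: "g \<noteq> 0"
      have "degree g \<ge> d" using int_minpoly_degree_le[OF f gz g0] unfolding d_def .
      hence "lead_coeff g = 0" by (simp add: cg)
      thus False using g0 by simp
    qed
    hence "b i = 0" if "i < d" for i using cg[of i] that by simp
    thus ?thesis using D by (metis mult_eq_0_iff of_int_0 of_int_eq_0_iff)
  qed
  show ?thesis using simple_extension_degree(1)[OF subfield_Rats span indep] unfolding d by blast
qed

section \<open>Square roots in the cyclotomic field\<close>

text \<open>Evaluate \<open>1 + X + ... + X ^ (n - 1)\<close>, whose roots are the \<open>z ^ k\<close> with \<open>0 < k < n\<close>,
  at 1.\<close>

lemma prod_one_minus_roots_of_unity:
  fixes z :: complex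
  assumes n: "n > 0" and prim: "\<And>k. z ^ k = 1 \<longleftrightarrow> n dvd k"
  shows "(\<Prod>k\<in>{1..<n}. 1 - z ^ k) = of_nat n"
proof -
  have z1: "z ^ k \<noteq> 1" if "k \<in> {1..<n}" for k using that prim[of k] by (auto dest: dvd_imp_le)
  have inj: "inj_on (\<lambda>k. z ^ k) {1..<n}"
    by (auto simp: inj_on_def primitive_root_power_eq_iff[OF n prim] cong_less_modulus_unique_nat)
  define P where "P = (\<Sum>i<n. monom (1::complex) i)"
  define Q where "Q = (\<Prod>k\<in>{1..<n}. [:- (z ^ k), 1:])"
  have "P = Q"
  proof (rule poly_eqI_degree_lead_coeff[of _ "n - 1" _ "(\<lambda>k. z ^ k) ` {1..<n}"])
    have dQ: "degree Q = n - 1" unfolding Q_def by (subst degree_prod_eq_sum_degree) auto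
    have "lead_coeff Q = 1" unfolding Q_def by (subst lead_coeff_prod) auto
    thus "coeff P (n - 1) = coeff Q (n - 1)" using n dQ unfolding P_def by (simp add: coeff_sum)
    show "degree Q \<le> n - 1" using dQ by simp
    show "degree P \<le> n - 1" unfolding P_def
      by (intro degree_sum_le) (auto intro: order.trans[OF degree_monom_le])
    show "n - 1 \<le> card ((\<lambda>k. z ^ k) ` {1..<n})" using inj by (simp add: card_image)
    fix w assume "w \<in> (\<lambda>k. z ^ k) ` {1..<n}"
    then obtain k where k: "k \<in> {1..<n}" "w = z ^ k" by blast
    have "w ^ n = 1" unfolding k(2) using prim[of "k * n"] by (simp add: power_mult)
    moreover have "poly P w = (\<Sum>i<n. w ^ i)" unfolding P_def by (simp add: poly_sum poly_monom)
    ultimately have "poly P w = 0" using z1[OF k(1)] k(2) by (simp add: sum_gp_strict)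
    moreover have "poly Q w = 0" unfolding Q_def poly_prod using k by (intro prod_zero) auto
    ultimately show "poly P w = poly Q w" by simp
  qed
  hence "poly P 1 = poly Q 1" by simp
  thus ?thesis unfolding P_def Q_def by (simp add: poly_sum poly_prod poly_monom)
qed

text \<open>In \<open>p = (1 - y) * (1 - y ^ 2) * ... * (1 - y ^ (p - 1))\<close> pair the factor for \<open>k\<close> with the one
  for \<open>p - k\<close>, using \<open>1 - y ^ (p - k) = - y ^ (p - k) * (1 - y ^ k)\<close>. As \<open>p\<close> is odd, \<open>y\<close> is
  the square of one of its own powers, and each pair is the negative of a square in the field. The
  \<open>(p - 1) div 2\<close> signs make up exactly the sign of \<open>prime_star p\<close>.\<close>

lemma sqrt_prime_star_in_cyclotomic:
  assumes p: "odd p" and prim: "\<And>k. y ^ k = 1 \<longleftrightarrow> p dvd k"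
    and F: "subfield F complex_field" "y \<in> F"
  shows "csqrt (of_int (prime_star p)) \<in> F"
proof -
  have p0: "p > 0" using p by (rule odd_pos)
  define h where "h = (p - 1) div 2"
  have ph: "p = 2 * h + 1" using p unfolding h_def by (auto elim: oddE)
  define m where "m = y ^ (h + 1)"
  have m2: "m\<^sup>2 = y"
  proof -
    have "m\<^sup>2 = y ^ ((h + 1) * 2)" unfolding m_def by (rule power_mult[symmetric])
    also have "(h + 1) * 2 = p + 1" using ph by simp
    also have "y ^ (p + 1) = y ^ p * y" by simp
    also have "y ^ p = 1" using prim by simp
    finally show ?thesis by simp
  qed
  define w where "w = (\<Prod>k\<in>{1..h}. m ^ (p - k) * (1 - y ^ k))"
  have "of_nat p = (\<Prod>k\<in>{1..<p}. 1 - y ^ k)"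
    using prod_one_minus_roots_of_unity[OF p0 prim] by simp
  also have "{1..<p} = {1..h} \<union> {h+1..<p}" using ph by auto
  also have "(\<Prod>k\<in>{1..h} \<union> {h+1..<p}. 1 - y ^ k) = (\<Prod>k\<in>{1..h}. 1 - y ^ k) * (\<Prod>k\<in>{h+1..<p}. 1 - y ^ k)"
    by (subst prod.union_disjoint) auto
  also have "(\<Prod>k\<in>{h+1..<p}. 1 - y ^ k) = (\<Prod>k\<in>{1..h}. 1 - y ^ (p - k))"
    by (rule prod.reindex_bij_witness[of _ "\<lambda>k. p - k" "\<lambda>k. p - k"]) (use ph in auto)
  also have "(\<Prod>k\<in>{1..h}. 1 - y ^ k) * \<dots> = (\<Prod>k\<in>{1..h}. - (m ^ (p - k) * (1 - y ^ k))\<^sup>2)"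
    unfolding prod.distrib[symmetric]
  proof (rule prod.cong[OF refl])
    fix k assume "k \<in> {1..h}"
    hence "y ^ (p - k) * y ^ k = y ^ p" using ph by (simp flip: power_add)
    also have "\<dots> = 1" using prim by simp
    finally have "1 - y ^ (p - k) = - (y ^ (p - k) * (1 - y ^ k))" by (simp add: algebra_simps)
    moreover have "y ^ (p - k) = (m ^ (p - k))\<^sup>2" using m2 by (metis power_mult mult.commute)
    ultimately show "(1 - y ^ k) * (1 - y ^ (p - k)) = - (m ^ (p - k) * (1 - y ^ k))\<^sup>2"
      by (simp add: power2_eq_square)
  qed
  also have "\<dots> = (\<Prod>k\<in>{1..h}. (-1) * (m ^ (p - k) * (1 - y ^ k))\<^sup>2)" by simp
  also have "\<dots> = (-1) ^ h * w\<^sup>2"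
  proof -
    have "(\<Prod>k\<in>{1..h}. -1 :: complex) = (-1) ^ h" by simp
    thus ?thesis unfolding w_def prod_power_distrib by (subst prod.distrib) (simp only:)
  qed
  finally have "of_int (prime_star p) = w\<^sup>2"
    unfolding prime_star_def h_def[symmetric] by (cases "even h") simp_all
  hence "(csqrt (of_int (prime_star p)))\<^sup>2 = w\<^sup>2" by (simp only: power2_csqrt)
  hence "csqrt (of_int (prime_star p)) = w \<or> csqrt (of_int (prime_star p)) = - w"
    by (rule power2_eq_iff[THEN iffD1])
  moreover have "w \<in> F"
  proof -
    have pow: "x ^ k \<in> F" if "x \<in> F" for x k using subfield_power[OF F(1) that] .
    show ?thesis
      unfolding w_def m_def
      by (rule subfield_prod[OF F(1)]) (simp only: pow F(2) subfieldD(2,4,7)[OF F(1)])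
  qed
  ultimately show ?thesis using subfieldD(5)[OF F(1)] by auto
qed

section \<open>The multiquadratic field over the rationals\<close>

text \<open>A rational value would be an integer, being integral over the integers, and its square would
  contain each prime of \<open>T\<close> exactly once.\<close>

lemma prod_sqrt_prime_star_irrational:
  assumes fin: "finite T" and T: "T \<noteq> {}" "\<And>p. p \<in> T \<Longrightarrow> prime p"
  shows "(\<Prod>p\<in>T. csqrt (of_int (prime_star p))) \<notin> \<rat>"
proof
  define x where "x = (\<Prod>p\<in>T. csqrt (of_int (prime_star p)))"
  define N where "N = (\<Prod>p\<in>T. prime_star p)"
  assume "(\<Prod>p\<in>T. csqrt (of_int (prime_star p))) \<in> \<rat>"
  hence xQ: "x \<in> \<rat>" unfolding x_def .
  have x2: "x\<^sup>2 = of_int N" unfolding x_def N_def prod_power_distrib by simp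
  have "algebraic_int x"
    by (rule algebraic_int.intros[of "[:- of_int N, 0, 1:]"])
       (use x2 in \<open>auto simp: power2_eq_square coeff_pCons split: nat.splits\<close>)
  then obtain m where "x = of_int m" using rational_algebraic_int_is_int xQ by (metis Ints_cases)
  hence "of_int (m\<^sup>2) = (of_int N :: complex)" using x2 by simp
  hence mN: "m\<^sup>2 = N" by (simp only: of_int_eq_iff)
  obtain p where p: "p \<in> T" using T(1) by blast
  have pp: "prime (int p)" using T(2)[OF p] by simp
  define N' where "N' = (\<Prod>q\<in>T - {p}. prime_star q)"
  have N: "N = int p * ((-1) ^ ((p - 1) div 2) * N')"
    unfolding N_def N'_def using prod.remove[OF fin p, of prime_star] by (simp add: prime_star_def mult_ac)
  have "int p dvd m\<^sup>2" unfolding mN N by simp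
  hence "int p dvd m" using pp prime_dvd_power by blast
  then obtain k where "m = int p * k" by (elim dvdE)
  hence "int p * (int p * k\<^sup>2) = int p * ((-1) ^ ((p - 1) div 2) * N')"
    using mN unfolding N by (simp add: power2_eq_square mult_ac)
  hence "int p * k\<^sup>2 = (-1) ^ ((p - 1) div 2) * N'" using pp by (metis mult_cancel_left not_prime_0)
  hence "int p dvd (-1) ^ ((p - 1) div 2) * N'" by (metis dvd_triv_left)
  hence "int p dvd N'" by (simp add: minus_one_power_iff split: if_splits)
  then obtain q where q: "q \<in> T - {p}" "int p dvd prime_star q"
    unfolding N'_def using prime_dvd_prod_iff[of "T - {p}" "int p"] fin pp by auto
  hence "p dvd q" unfolding prime_star_def by (simp add: minus_one_power_iff split: if_splits)
  thus False using q(1) T(2) p primes_dvd_imp_eq by blast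
qed

lemma multiquadratic_rational_degree:
  "CF.dimension (2 ^ prime_omega n) \<rat> (multiquadratic_field n)"
proof -
  define s where "s = (\<lambda>p. csqrt (of_int (prime_star p)))"
  have inj: "inj_on s (prime_factors n)"
  proof (rule inj_onI)
    fix p q assume pq: "p \<in> prime_factors n" "q \<in> prime_factors n" "s p = s q"
    hence "(of_int (prime_star p) :: complex) = of_int (prime_star q)"
      unfolding s_def by (metis power2_csqrt)
    hence "\<bar>prime_star p\<bar> = \<bar>prime_star q\<bar>" by simp
    thus "p = q" by (simp add: prime_star_def abs_mult)
  qed
  have "CF.dimension (2 ^ card (s ` prime_factors n)) \<rat> (adjoin \<rat> (s ` prime_factors n))"
  proof (rule multiquadratic_degree[OF _ subfield_Rats])
    show "x\<^sup>2 \<in> \<rat>" if "x \<in> s ` prime_factors n" for x using that unfolding s_def by auto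
    fix T assume T: "T \<subseteq> s ` prime_factors n" "T \<noteq> {}"
    then obtain U where U: "U \<subseteq> prime_factors n" "T = s ` U" by (meson subset_imageE)
    have "\<Prod>T = (\<Prod>p\<in>U. s p)"
      using U inj by (simp add: prod.reindex inj_on_subset)
    moreover have "finite U" using U(1) finite_subset by blast
    ultimately show "\<Prod>T \<notin> \<rat>"
      using prod_sqrt_prime_star_irrational[of U] U T(2) unfolding s_def by auto
  qed simp
  thus ?thesis
    using inj by (simp add: card_image prime_omega_def multiquadratic_field_def rat_adjoin_def s_def)
qed

section \<open>The relative degree\<close>

lemma exp_root_of_unity_primitive:
  assumes n: "n > 0"
  shows "exp (2 * of_real pi * \<i> / of_nat n) ^ k = 1 \<longleftrightarrow> n dvd k"
proof -
  define z where "z = exp (2 * of_real pi * \<i> / of_nat n)"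
  have zk: "z ^ j = cis (2 * pi * real j / real n)" for j
  proof -
    have "z = cis (2 * pi / real n)" unfolding z_def cis_conv_exp by (simp add: mult_ac)
    thus ?thesis by (simp add: DeMoivre mult_ac)
  qed
  have zn: "z ^ n = 1" using n zk[of n] by simp
  have "z ^ k = z ^ (n * (k div n) + k mod n)" by simp
  also have "\<dots> = z ^ (k mod n)" unfolding power_add power_mult zn by simp
  finally have "z ^ k = 1 \<longleftrightarrow> z ^ (k mod n) = z ^ 0" by simp
  also have "\<dots> \<longleftrightarrow> k mod n = 0"
  proof (rule inj_on_eq_iff)
    show "inj_on (\<lambda>j. z ^ j) {..<n}"
      unfolding zk by (rule bij_betw_imp_inj_on[OF bij_betw_roots_unity[OF n]])
  qed (use n in auto)
  also have "\<dots> \<longleftrightarrow> n dvd k" by (rule mod_eq_0_iff_dvd)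
  finally show ?thesis unfolding z_def .
qed

theorem corollary5p3:
  fixes n :: nat
  assumes "n > 0" and "odd n" and "squarefree n"
  shows "multiquadratic_field n \<subseteq> cyclotomic_field n \<and>
         ring.finite_dimension complex_field (multiquadratic_field n) (cyclotomic_field n) \<and>
         varrho n = of_nat (field_degree (cyclotomic_field n) (multiquadratic_field n)) \<and>
         varrho n \<in> \<int> \<and> varrho n > 0 \<and>
         2 ^ prime_omega n dvd totient n"
proof -
  define z where "z = exp (2 * of_real pi * \<i> / of_nat n)"
  define K where "K = multiquadratic_field n"
  define L where "L = cyclotomic_field n"
  have n: "n > 0" by fact
  have prim: "z ^ k = 1 \<longleftrightarrow> n dvd k" for k
    unfolding z_def by (rule exp_root_of_unity_primitive[OF n])
  have L_eq: "L = adjoin \<rat> {z}" unfolding L_def cyclotomic_field_def rat_adjoin_def z_def ..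
  have K: "subfield K complex_field" unfolding K_def multiquadratic_field_def by (rule subfield_rat_adjoin)
  have L: "subfield L complex_field" unfolding L_eq by (rule subfield_adjoin)
  have dimL: "CF.dimension (totient n) \<rat> L" unfolding L_eq by (rule cyclotomic_degree[OF n prim])
  have dimK: "CF.dimension (2 ^ prime_omega n) \<rat> K" unfolding K_def by (rule multiquadratic_rational_degree)
  have zL: "z \<in> L" unfolding L_eq by (rule generate_field.incl) simp
  have KL: "K \<subseteq> L"
    unfolding K_def multiquadratic_field_def rat_adjoin_def
  proof (rule adjoin_minimal[OF L])
    show "\<rat> \<subseteq> L" unfolding L_eq by (rule adjoin_incl)
    show "(\<lambda>p. csqrt (of_int (prime_star p))) ` prime_factors n \<subseteq> L"
    proof clarify
      fix p assume "p \<in> prime_factors n"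
      hence p: "p dvd n" by auto
      have "odd p" using p \<open>odd n\<close> by auto
      show "csqrt (of_int (prime_star p)) \<in> L"
      proof (rule sqrt_prime_star_in_cyclotomic[OF \<open>odd p\<close> _ L])
        show "z ^ (n div p) \<in> L" by (rule subfield_power[OF L zL])
        fix k
        obtain q where q: "n = p * q" using p by (elim dvdE)
        have "n dvd n div p * k \<longleftrightarrow> p dvd k" using q n by (simp add: mult.commute[of q])
        thus "(z ^ (n div p)) ^ k = 1 \<longleftrightarrow> p dvd k" using prim by (simp flip: power_mult)
      qed
    qed
  qed
  \<comment> \<open>The cyclotomic field is also generated by \<^term>\<open>z\<close> over \<^term>\<open>K\<close>, hence finite over
    \<^term>\<open>K\<close>.\<close>
  have QK: "\<rat> \<subseteq> K" unfolding K_def multiquadratic_field_def rat_adjoin_def by (rule adjoin_incl)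
  have "(CF.algebraic over \<rat>) z"
    using CF.finite_dimension_imp_algebraic[OF subfield_Rats subfieldE(1)[OF L] CF.finite_dimensionI[OF dimL] zL] .
  hence alg: "(CF.algebraic over K) z" using CF.algebraic_mono[OF QK] by simp
  have "adjoin K {z} = L"
  proof
    show "adjoin K {z} \<subseteq> L" using KL zL by (intro adjoin_minimal L) auto
    show "L \<subseteq> adjoin K {z}" unfolding L_eq
      by (intro adjoin_minimal subfield_adjoin) (use QK in \<open>auto intro: generate_field.incl\<close>)
  qed
  hence "L = CF.simple_extension K z" using adjoin_eq_simple_extension[OF K alg] by simp
  hence fd: "CF.finite_dimension K L" using CF.finite_dimension_simple_extension[OF K] alg by simp
  have "(CF.dim over \<rat>) L = (CF.dim over \<rat>) K * (CF.dim over K) L"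
    by (rule CF.telescopic_base_dim(2)[OF subfield_Rats K CF.finite_dimensionI[OF dimK] fd])
  hence tot: "totient n = 2 ^ prime_omega n * field_degree L K"
    using CF.dimI[OF subfield_Rats dimL] CF.dimI[OF subfield_Rats dimK] unfolding field_degree_def by simp
  have vr: "varrho n = of_nat (field_degree L K)" unfolding varrho_def tot by simp
  have "totient n > 0" using n by simp
  hence "field_degree L K > 0" unfolding tot by simp
  thus ?thesis using KL fd vr tot unfolding K_def L_def by auto
qed

end
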